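(* For every $p\in[0,1]$, the greedy-based algorithm with parameter $p$ for random-order online weighted bipartite matching with one-sided vertex arrivals is order-oblivious $\frac{p(1-p)}{1+p}$-competitive. That is, for every bipartite graph $G=(L,R,E)$ with weights $w:E\to\mathbb{R}_{\ge 0}$, and for any arrival order of the vertices of $L\setminus L'$ after the sampling phase (possibly adversarial and depending on the sample $L'$), the matching output by the algorithm has expected weight at least $\frac{p(1-p)}{1+p}\cdot \mathrm{OPT}$.
   Context: Setting. An adversary chooses a finite bipartite graph $G=(L,R,E)$ with weights $w:E\to\mathbb{R}_{\ge0}$; ties between weights are broken by a fixed consistent rule, so edge weights are totally ordered. $R$ and $|L|$ are known upfront. The vertices of $L$ arrive online; when $u\in L$ arrives, its incident edges and their weights are revealed and it must be irrevocably matched to a currently unmatched neighbor or left unmatched. $\mathrm{OPT}$ is the maximum weight of a matching in $G$. For $U\subseteq L$, $G[U]$ denotes the subgraph induced on $U\cup R$. $\mathrm{Greedy}(H)$: process the edges of $H$ in non-increasing order of weight, adding an edge to the matching iff neither of its endpoints is already covered. Greedy-based algorithm with parameter $p$: (1) draw $k\sim\mathrm{Binom}(|L|,p)$ and let $L'$ be the first $k$ vertices in a uniformly random arrival order of $L$ (sampling phase; equivalently each vertex of $L$ is in $L'$ independently with probability $p$); set $M=\emptyset$. (2) When a later vertex $u\in L\setminus L'$ arrives, compute $\mathrm{Greedy}(G[L'\cup\{u\}])$; if $u$ is matched in it by an edge $(u,r)$ and $r$ is not yet matched in $M$, add $(u,r)$ to $M$. Output $M$. The algorithm is order-oblivious $c$-competitive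 if its expected output weight is at least $c\cdot\mathrm{OPT}$ on every instance, for any (possibly adversarial) arrival order of $L\setminus L'$ after the sampling phase. *)

theory Defs
  imports "HOL-Probability.Probability"
begin

text \<open>
  An edge is a pair whose first component is the online endpoint (in \<open>L\<close>) and whose second
  component is the offline endpoint (in \<open>R\<close>); the two sides are disjoint because they are
  distinguished by position, even if the types coincide.
\<close>

definition weighted_bipartite ::
    "'l set \<Rightarrow> 'r set \<Rightarrow> ('l \<times> 'r) set \<Rightarrow> ('l \<times> 'r \<Rightarrow> real) \<Rightarrow> bool" where
  "weighted_bipartite L R E w \<longleftrightarrow>
     finite L \<and> finite R \<and> E \<subseteq> L \<times> R \<and> (\<forall>e\<in>E. 0 \<le> w e)"

definition matching :: "('l \<times> 'r) set \<Rightarrow> ('l \<times> 'r) set \<Rightarrow> bool" where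
  "matching E M \<longleftrightarrow> M \<subseteq> E \<and> inj_on fst M \<and> inj_on snd M"

definition OPT :: "('l \<times> 'r) set \<Rightarrow> ('l \<times> 'r \<Rightarrow> real) \<Rightarrow> real" where
  "OPT E w = Max {sum w M | M. matching E M}"

text \<open>
  A fixed consistent tie-breaking rule is a total order on \<open>E\<close> refining the order by
  non-increasing weight. As \<open>E\<close> is finite, it is represented by the list of all edges in this
  order; the edges of every subgraph are processed in the order induced by that one list.
\<close>

definition weight_order :: "('l \<times> 'r) set \<Rightarrow> ('l \<times> 'r \<Rightarrow> real) \<Rightarrow> ('l \<times> 'r) list \<Rightarrow> bool" where
  "weight_order E w es \<longleftrightarrow>
     set es = E \<and> distinct es \<and> sorted_wrt (\<lambda>e f. w e \<ge> w f) es"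

definition greedy_step :: "'l \<times> 'r \<Rightarrow> ('l \<times> 'r) set \<Rightarrow> ('l \<times> 'r) set" where
  "greedy_step e M = (if fst e \<notin> fst ` M \<and> snd e \<notin> snd ` M then insert e M else M)"

definition greedy :: "('l \<times> 'r) list \<Rightarrow> ('l \<times> 'r) set" where
  "greedy es = fold greedy_step es {}"

text \<open>The ordered list of the edges of \<open>G[U]\<close>, the subgraph induced on \<open>U \<union> R\<close>.\<close>

definition induced :: "('l \<times> 'r) list \<Rightarrow> 'l set \<Rightarrow> ('l \<times> 'r) list" where
  "induced es U = filter (\<lambda>e. fst e \<in> U) es"

text \<open>
  The set added to \<open>M\<close> has at most one element, because the greedy result is a matching.
\<close>

definition online_step ::
    "('l \<times> 'r) list \<Rightarrow> 'l set \<Rightarrow> 'l \<Rightarrow> ('l \<times> 'r) set \<Rightarrow> ('l \<times> 'r) set" where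
  "online_step es S u M =
     M \<union> {(u, r) | r. (u, r) \<in> greedy (induced es (S \<union> {u})) \<and> r \<notin> snd ` M}"

text \<open>
  The output for sample \<open>S\<close> when the remaining vertices arrive in the order of the list \<open>us\<close>.
\<close>

definition greedy_based ::
    "('l \<times> 'r) list \<Rightarrow> 'l set \<Rightarrow> 'l list \<Rightarrow> ('l \<times> 'r) set" where
  "greedy_based es S us = fold (online_step es S) us {}"

definition sample_pmf :: "'l set \<Rightarrow> real \<Rightarrow> 'l set pmf" where
  "sample_pmf L p =
     do {
       k \<leftarrow> binomial_pmf (card L) p;
       xs \<leftarrow> pmf_of_set (permutations_of_set L);
       return_pmf (set (take k xs))
     }"

end

theory Submission
  imports Defs
begin

text \<open>
  Process all edges by non-increasing weight, deciding whether \<open>u \<in> L\<close> is in the sample \<open>S\<close> (heads)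
  or not (tails) only at the first edge \<open>(u, r)\<close> whose end \<open>r\<close> is not yet covered by a heads edge;
  let \<open>F\<close> be the set of edges at which a coin is flipped. The heads edges form
  \<open>Greedy(G[S])\<close>, and the tails edges are those proposed by the algorithm after the sampling phase.
  Each edge is dominated by the edge of \<open>F\<close> at its left end or by the heads edge at its right end,
  so \<open>OPT \<le> w(F) + w(heads)\<close>, and \<open>w(heads)\<close> has expectation \<open>p E[w(F)]\<close>. Whatever the
  arrival order, each \<open>r\<close> gets at least its lightest, i.e. last, tails edge. A flipped edge comes up
  tails and is not superseded by a later tails edge at the same \<open>r\<close> with probability at least
  \<open>p (1 - p)\<close>, hence the output has expected weight at least \<open>p (1 - p) E[w(F)]\<close>.
\<close>

section \<open>The coin-flip process\<close>

definition heads :: "'l set \<Rightarrow> ('l \<times> 'r) set \<Rightarrow> ('l \<times> 'r) set" where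
  "heads S F = {e \<in> F. fst e \<in> S}"

definition tails :: "'l set \<Rightarrow> ('l \<times> 'r) set \<Rightarrow> ('l \<times> 'r) set" where
  "tails S F = {e \<in> F. fst e \<notin> S}"

text \<open>All coins are fixed in advance by \<open>S\<close> but consulted only through
  \<open>heads S F\<close>. Tails edges do not block their right end, so several of them may share
  it.\<close>

definition flip_step :: "'l set \<Rightarrow> 'l \<times> 'r \<Rightarrow> ('l \<times> 'r) set \<Rightarrow> ('l \<times> 'r) set" where
  "flip_step S e F =
     (if fst e \<notin> fst ` F \<and> snd e \<notin> snd ` heads S F then insert e F else F)"

definition flips :: "'l set \<Rightarrow> ('l \<times> 'r) list \<Rightarrow> ('l \<times> 'r) set" where
  "flips S es = fold (flip_step S) es {}"

lemma flips_Nil [simp]: "flips S [] = {}"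
  by (simp add: flips_def)

lemma flips_snoc: "flips S (es @ [e]) = flip_step S e (flips S es)"
  by (simp add: flips_def)

lemma flips_subset: "flips S es \<subseteq> set es"
  by (induction es rule: rev_induct) (auto simp: flips_snoc flip_step_def)

lemma finite_flips [simp]: "finite (flips S es)"
  by (rule finite_subset [OF flips_subset]) simp

lemma finite_heads [simp]: "finite F \<Longrightarrow> finite (heads S F)"
  by (simp add: heads_def)

lemma finite_tails [simp]: "finite F \<Longrightarrow> finite (tails S F)"
  by (simp add: tails_def)

lemma heads_insert: "heads S (insert e F) = (if fst e \<in> S then insert e (heads S F) else heads S F)"
  by (auto simp: heads_def)

lemma tails_insert: "tails S (insert e F) = (if fst e \<in> S then tails S F else insert e (tails S F))"
  by (auto simp: tails_def)

lemma heads_insert_sample: "u \<notin> fst ` F \<Longrightarrow> heads (insert u S) F = heads S F"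
  by (auto simp: heads_def)

lemma tails_insert_sample: "u \<notin> fst ` F \<Longrightarrow> tails (insert u S) F = tails S F"
  by (auto simp: tails_def)

lemma inj_on_fst_flips: "inj_on fst (flips S es)"
  by (induction es rule: rev_induct) (auto simp: flips_snoc flip_step_def)

lemma inj_on_snd_heads_flips: "inj_on snd (heads S (flips S es))"
  by (induction es rule: rev_induct)
     (auto simp: flips_snoc flip_step_def heads_insert, auto simp: heads_def)

section \<open>Flips, greedy matchings and the online algorithm\<close>

text \<open>Tails edges block no right end and share no left end with a sampled vertex. They are
  thus invisible to the heads edges, which evolve by \<open>greedy_step\<close>.\<close>

lemma greedy_induced: "greedy (induced es S) = heads S (flips S es)"
proof (induction es rule: rev_induct)
  case Nil
  show ?case by (simp add: greedy_def induced_def heads_def)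
next
  case (snoc e es)
  have "greedy (induced (es @ [e]) S) =
      (if fst e \<in> S then greedy_step e (greedy (induced es S)) else greedy (induced es S))"
    by (simp add: greedy_def induced_def)
  also have "\<dots> = heads S (flips S (es @ [e]))"
    unfolding snoc.IH flips_snoc flip_step_def greedy_step_def
    by (auto simp: heads_def)
  finally show ?case .
qed

text \<open>Membership of \<open>u\<close> is consulted only after \<open>u\<close> has flipped.
  Until then the two runs coincide; then they add the same edge, and afterwards neither adds another
  edge at \<open>u\<close>. The second conjunct carries the induction up to the flip.\<close>

lemma flips_insert_sample:
  "{e \<in> flips (insert u S) es. fst e = u} = {e \<in> flips S es. fst e = u} \<and>
   (u \<notin> fst ` flips S es \<longrightarrow> flips (insert u S) es = flips S es)"
proof (induction es rule: rev_induct)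
  case Nil
  show ?case by simp
next
  case (snoc e es)
  show ?case
  proof (cases "u \<in> fst ` flips S es")
    case True
    then have "u \<in> fst ` flips (insert u S) es" using snoc.IH by blast
    with True snoc.IH show ?thesis
      by (auto simp: flips_snoc flip_step_def)
  next
    case False
    then have "flips (insert u S) es = flips S es" using snoc.IH by blast
    with False show ?thesis
      by (auto simp: flips_snoc flip_step_def heads_insert_sample)
  qed
qed

lemma flips_insert_sample_eq:
  "u \<notin> fst ` flips S es \<Longrightarrow> flips (insert u S) es = flips S es"
  using flips_insert_sample [of u S es] by (rule conjunct2 [THEN mp])

lemma covered_flips_insert_sample:
  "u \<in> fst ` flips (insert u S) es \<longleftrightarrow> u \<in> fst ` flips S es"
proof -
  have "u \<in> fst ` F \<longleftrightarrow> {e \<in> F. fst e = u} \<noteq> {}" for F :: "('a \<times> 'b) set"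
    by (auto intro: rev_image_eqI)
  then show ?thesis
    by (simp only: conjunct1 [OF flips_insert_sample [of u S es]])
qed

text \<open>Putting \<open>u\<close> into the sample turns its flip into heads without changing the
  edge at which it occurs. Hence all proposals can be read off the single run for
  \<open>S\<close>.\<close>

lemma mem_greedy_induced_insert_iff:
  "(u, r) \<in> greedy (induced es (S \<union> {u})) \<longleftrightarrow> (u, r) \<in> flips S es"
proof -
  have "(u, r) \<in> greedy (induced es (S \<union> {u})) \<longleftrightarrow> (u, r) \<in> flips (insert u S) es"
    by (simp add: greedy_induced heads_def)
  also have "\<dots> \<longleftrightarrow> (u, r) \<in> {e \<in> flips (insert u S) es. fst e = u}" by simp
  also have "\<dots> \<longleftrightarrow> (u, r) \<in> flips S es"
    unfolding conjunct1 [OF flips_insert_sample] by simp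
  finally show ?thesis .
qed

text \<open>The first arrival to propose a right end takes it and later ones are refused, so every
  proposed right end is matched whatever the order.\<close>

lemma greedy_based_properties:
  fixes es :: "('l \<times> 'r) list"
  defines "F S \<equiv> flips S es"
  shows "greedy_based es S us \<subseteq> F S \<and> fst ` greedy_based es S us \<subseteq> set us \<and>
     inj_on snd (greedy_based es S us) \<and>
     (\<forall>e\<in>F S. fst e \<in> set us \<longrightarrow> snd e \<in> snd ` greedy_based es S us)"
proof (induction us rule: rev_induct)
  case Nil
  show ?case by (simp add: greedy_based_def)
next
  case (snoc u us)
  let ?M = "greedy_based es S us"
  have step: "greedy_based es S (us @ [u]) = ?M \<union> {(u, r) | r. (u, r) \<in> F S \<and> r \<notin> snd ` ?M}"
    by (simp add: greedy_based_def online_step_def mem_greedy_induced_insert_iff [symmetric] F_def)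
  have inj: "r = r'" if "(u, r) \<in> F S" "(u, r') \<in> F S" for r r'
    using inj_onD [OF inj_on_fst_flips, of "(u, r)" "(u, r')" S es] that by (simp add: F_def)
  have new: "(a, r) \<notin> ?M" if "r \<notin> snd ` ?M" for a r
    using that by (metis image_eqI snd_conv)
  have "inj_on snd (greedy_based es S (us @ [u]))"
    unfolding step using snoc.IH by (auto simp: inj_on_Un inj_on_def dest: inj new)
  moreover have "\<forall>e\<in>F S. fst e \<in> set (us @ [u]) \<longrightarrow>
      snd e \<in> snd ` greedy_based es S (us @ [u])"
  proof (intro ballI impI)
    fix e assume e: "e \<in> F S" "fst e \<in> set (us @ [u])"
    show "snd e \<in> snd ` greedy_based es S (us @ [u])"
    proof (cases "snd e \<in> snd ` ?M")
      case True
      then show ?thesis unfolding step by blast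
    next
      case False
      then have "fst e = u" using e snoc.IH by auto
      then have "e \<in> {(u, r) | r. (u, r) \<in> F S \<and> r \<notin> snd ` ?M}"
        using e False by (cases e) auto
      then show ?thesis unfolding step by blast
    qed
  qed
  moreover have "greedy_based es S (us @ [u]) \<subseteq> F S" unfolding step using snoc.IH by blast
  moreover have "fst ` greedy_based es S (us @ [u]) \<subseteq> set (us @ [u])"
    unfolding step image_Un using snoc.IH by auto
  ultimately show ?case by blast
qed

section \<open>Weight secured under every arrival order\<close>

definition min_tail :: "('l \<times> 'r \<Rightarrow> real) \<Rightarrow> 'l set \<Rightarrow> ('l \<times> 'r) set \<Rightarrow> 'r \<Rightarrow> real" where
  "min_tail w S F r =
     (if r \<in> snd ` tails S F then Min (w ` {e \<in> tails S F. snd e = r}) else 0)"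

lemma sum_greedy_based_ge:
  assumes "finite R" "snd ` flips S es \<subseteq> R" "fst ` flips S es - S \<subseteq> set us"
      "set us \<inter> S = {}"
  shows "(\<Sum>r\<in>R. min_tail w S (flips S es) r) \<le> sum w (greedy_based es S us)"
proof -
  let ?F = "flips S es" and ?M = "greedy_based es S us"
  note P = greedy_based_properties [of es S us]
  have M: "?M \<subseteq> tails S ?F" using P assms(4) by (fastforce simp: tails_def)
  have cover: "snd ` tails S ?F \<subseteq> snd ` ?M" using P assms(3) by (auto simp: tails_def)
  have sub: "snd ` ?M \<subseteq> R" using P assms(2) by blast
  \<comment> \<open>By \<open>cover\<close>, an unmatched right end has no tails edge, so its term
    is the default 0.\<close>
  have "(\<Sum>r\<in>R. min_tail w S ?F r) = (\<Sum>r\<in>snd ` ?M. min_tail w S ?F r)"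
    by (rule sum.mono_neutral_right) (use assms(1) sub cover in \<open>auto simp: min_tail_def\<close>)
  also have "\<dots> = (\<Sum>e\<in>?M. min_tail w S ?F (snd e))"
    using P by (simp add: sum.reindex)
  also have "\<dots> \<le> sum w ?M"
  proof (rule sum_mono)
    fix e assume "e \<in> ?M"
    then have e: "e \<in> tails S ?F" using M by blast
    then show "min_tail w S ?F (snd e) \<le> w e"
      by (auto simp: min_tail_def intro!: Min_le)
  qed
  finally show ?thesis .
qed

section \<open>Bounding the optimum by the flips\<close>

text \<open>An edge not flipped when reached is blocked by an edge processed earlier, hence at least
  as heavy; the blocking sets only grow afterwards.\<close>

lemma flips_dominate:
  assumes "sorted_wrt (\<lambda>e f. w f \<le> (w e :: real)) es" "e \<in> set es"
  shows "(\<exists>f\<in>flips S es. fst f = fst e \<and> w e \<le> w f) \<or>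
         (\<exists>f\<in>heads S (flips S es). snd f = snd e \<and> w e \<le> w f)"
  using assms
proof (induction es rule: rev_induct)
  case Nil
  then show ?case by simp
next
  case (snoc a es)
  have srt: "sorted_wrt (\<lambda>e f. w f \<le> w e) es" and le: "\<And>f. f \<in> flips S es \<Longrightarrow> w a \<le> w f"
    using snoc.prems(1) flips_subset [of S es] by (auto simp: sorted_wrt_append)
  show ?case
  proof (cases "e \<in> set es")
    case True
    with snoc.IH [OF srt] show ?thesis
      by (auto simp: flips_snoc flip_step_def heads_insert)
  next
    case False
    with snoc.prems(2) have "e = a" by simp
    show ?thesis
    proof (cases "fst a \<notin> fst ` flips S es \<and> snd a \<notin> snd ` heads S (flips S es)")
      case True
      then show ?thesis by (simp add: \<open>e = a\<close> flips_snoc flip_step_def)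
    next
      case False
      then have "flips S (es @ [a]) = flips S es"
        unfolding flips_snoc flip_step_def by (rule if_not_P)
      moreover have "heads S (flips S es) \<subseteq> flips S es" by (auto simp: heads_def)
      ultimately show ?thesis using False le \<open>e = a\<close> by (fastforce elim!: imageE)
    qed
  qed
qed

text \<open>Each element of \<open>A\<close> picks a dominating element with the same key; as
  \<open>k\<close> separates \<open>A\<close>, no element of \<open>B\<close> is picked
  twice.\<close>

lemma sum_le_by_dominating_injection:
  fixes w :: "'a \<Rightarrow> real"
  assumes "finite B" "inj_on k A" "\<And>b. b \<in> B \<Longrightarrow> 0 \<le> w b"
    and "\<And>a. a \<in> A \<Longrightarrow> \<exists>b\<in>B. k b = k a \<and> w a \<le> w b"
  shows "sum w A \<le> sum w B"
proof -
  obtain g where g: "\<And>a. a \<in> A \<Longrightarrow> g a \<in> B \<and> k (g a) = k a \<and> w a \<le> w (g a)"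
    using assms(4) by metis
  have inj: "inj_on g A" using g assms(2) by (metis inj_on_def)
  have "sum w A \<le> (\<Sum>a\<in>A. w (g a))" using g by (intro sum_mono) auto
  also have "\<dots> = sum w (g ` A)" using inj by (simp add: sum.reindex)
  also have "\<dots> \<le> sum w B" using g assms by (intro sum_mono2) auto
  finally show ?thesis .
qed

lemma matching_weight_le_flips:
  fixes w :: "'l \<times> 'r \<Rightarrow> real"
  assumes srt: "sorted_wrt (\<lambda>e f. w f \<le> w e) es" and nonneg: "\<And>e. e \<in> set es \<Longrightarrow> 0 \<le> w e"
    and M: "matching (set es) M"
  shows "sum w M \<le> sum w (flips S es) + sum w (heads S (flips S es))"
proof -
  let ?F = "flips S es"
  \<comment> \<open>Edges dominated at their left end inject into the flips via \<open>fst\<close>;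
    the others inject into the heads edges via \<open>snd\<close>.\<close>
  define A where "A = {e \<in> M. \<exists>f\<in>?F. fst f = fst e \<and> w e \<le> w f}"
  have M': "M \<subseteq> set es" "inj_on fst M" "inj_on snd M" using M by (auto simp: matching_def)
  have fin: "finite M" using M' by (auto intro: finite_subset)
  have nn: "0 \<le> w f" if "f \<in> ?F" for f using nonneg flips_subset that by blast
  have "sum w A \<le> sum w ?F"
    by (rule sum_le_by_dominating_injection [where k = fst])
       (use M' nn in \<open>auto simp: A_def intro: inj_on_subset\<close>)
  moreover have "sum w (M - A) \<le> sum w (heads S ?F)"
  proof (rule sum_le_by_dominating_injection [where k = snd])
    fix e assume "e \<in> M - A"
    then show "\<exists>f\<in>heads S ?F. snd f = snd e \<and> w e \<le> w f"
      using flips_dominate [OF srt, of e S] M' by (auto simp: A_def)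
  qed (use M' nn in \<open>auto simp: heads_def intro: inj_on_subset\<close>)
  moreover have "sum w M = sum w A + sum w (M - A)"
    using fin by (simp add: sum.subset_diff [of A M] A_def)
  ultimately show ?thesis by linarith
qed

lemma OPT_le:
  assumes "finite E" "\<And>M. matching E M \<Longrightarrow> sum w M \<le> c"
  shows "OPT E w \<le> c"
proof -
  have "{sum w M |M. matching E M} \<subseteq> sum w ` Pow E" by (auto simp: matching_def)
  then have "finite {sum w M |M. matching E M}" by (rule finite_subset) (simp add: assms(1))
  moreover have "matching E {}" by (simp add: matching_def)
  ultimately show ?thesis unfolding OPT_def using assms(2) by (subst Max_le_iff) auto
qed

section \<open>Distribution of the sample\<close>

text \<open>Cutting such a permutation after \<open>card S\<close> entries gives an ordering of
  \<open>S\<close> and one of \<open>L - S\<close>; concatenation inverts this.\<close>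

lemma card_permutations_set_take:
  assumes "finite L" "S \<subseteq> L"
  shows "card {xs \<in> permutations_of_set L. set (take (card S) xs) = S} =
    fact (card S) * fact (card L - card S)"
proof -
  let ?h = "\<lambda>(xs, ys). xs @ ys"
  have fS: "finite S" using assms finite_subset by blast
  have "{xs \<in> permutations_of_set L. set (take (card S) xs) = S} =
      ?h ` (permutations_of_set S \<times> permutations_of_set (L - S))" (is "?A = ?B")
  proof
    show "?A \<subseteq> ?B"
    proof
      fix xs assume xs: "xs \<in> ?A"
      let ?k = "card S"
      have d: "set xs = L" "distinct xs" "set (take ?k xs) = S"
        using xs by (auto simp: permutations_of_set_def)
      have "set (take ?k xs) \<union> set (drop ?k xs) = L"
        using d(1) by (metis append_take_drop_id set_append)
      moreover have "set (take ?k xs) \<inter> set (drop ?k xs) = {}"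
        using d(2) by (simp add: set_take_disj_set_drop_if_distinct)
      ultimately have "set (drop ?k xs) = L - S" using d(3) by blast
      then have "take ?k xs \<in> permutations_of_set S" "drop ?k xs \<in> permutations_of_set (L - S)"
        using d by (auto simp: permutations_of_set_def)
      then show "xs \<in> ?B"
        by (intro image_eqI [where x = "(take ?k xs, drop ?k xs)"]) auto
    qed
    show "?B \<subseteq> ?A"
      using assms(2) by (auto simp: permutations_of_set_def distinct_card)
  qed
  moreover have "inj_on ?h (permutations_of_set S \<times> permutations_of_set (L - S))"
  proof (rule inj_onI, clarify)
    fix xs ys xs' ys' :: "'a list"
    assume "xs \<in> permutations_of_set S" "xs' \<in> permutations_of_set S" and eq: "xs @ ys = xs' @ ys'"
    then have "length xs = length xs'"
      by (simp add: length_finite_permutations_of_set)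
    with eq show "xs = xs' \<and> ys = ys'" by simp
  qed
  ultimately show ?thesis
    using assms fS by (simp add: card_image card_cartesian_product card_Diff_subset)
qed

text \<open>Given its size, the sample is uniform, and the reciprocal binomial coefficient cancels
  the one in the binomial weight. What remains is independent sampling of each vertex.\<close>

lemma pmf_sample_pmf:
  assumes p: "p \<in> {0..1}" and L: "finite L" and S: "S \<subseteq> L"
  shows "pmf (sample_pmf L p) S = p ^ card S * (1 - p) ^ (card L - card S)"
proof -
  let ?n = "card L" and ?P = "permutations_of_set L"
  define q where "q k = pmf (map_pmf (\<lambda>xs. set (take k xs)) (pmf_of_set ?P)) S" for k
  have le: "card S \<le> ?n" using L S by (simp add: card_mono)
  have q: "q k = card {xs \<in> ?P. set (take k xs) = S} / fact ?n" for k
  proof -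
    have "q k = measure (measure_pmf (pmf_of_set ?P)) ((\<lambda>xs. set (take k xs)) -` {S})"
      by (simp add: q_def pmf_map)
    also have "\<dots> = card (?P \<inter> ((\<lambda>xs. set (take k xs)) -` {S})) / card ?P"
      using L by (subst measure_pmf_of_set) auto
    also have "?P \<inter> ((\<lambda>xs. set (take k xs)) -` {S}) = {xs \<in> ?P. set (take k xs) = S}" by auto
    finally show ?thesis using L by simp
  qed
  \<comment> \<open>For \<open>k\<close> up to \<open>card L\<close> a prefix of length
    \<open>k\<close> has exactly \<open>k\<close> distinct entries; the support of the binomial lies
    in this range.\<close>
  have q0: "q k = 0" if "k \<le> ?n" "k \<noteq> card S" for k
  proof -
    have "set (take k xs) \<noteq> S" if "xs \<in> ?P" for xs
    proof -
      have "length xs = ?n" "distinct xs"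
        using that L by (auto simp: permutations_of_set_def distinct_card)
      then have "card (set (take k xs)) = k" using \<open>k \<le> ?n\<close> by (simp add: distinct_card)
      then show ?thesis using \<open>k \<noteq> card S\<close> by auto
    qed
    then have "{xs \<in> ?P. set (take k xs) = S} = {}" by auto
    then show ?thesis by (simp add: q)
  qed
  have "pmf (sample_pmf L p) S = measure_pmf.expectation (binomial_pmf ?n p) q"
    unfolding sample_pmf_def q_def map_pmf_def by (subst pmf_bind) simp
  also have "\<dots> = (\<Sum>k\<le>?n. q k * pmf (binomial_pmf ?n p) k)"
    by (rule integral_measure_pmf_real) (use p set_pmf_binomial_eq [of p ?n] in \<open>auto split: if_splits\<close>)
  also have "\<dots> = (\<Sum>k\<in>{card S}. q k * pmf (binomial_pmf ?n p) k)"
    by (rule sum.mono_neutral_right) (use le q0 in auto)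
  also have "\<dots> = q (card S) * (real (?n choose card S) * p ^ card S * (1 - p) ^ (?n - card S))"
    using p by simp
  also have "\<dots> = p ^ card S * (1 - p) ^ (?n - card S)"
    using le L S by (simp add: q card_permutations_set_take binomial_fact)
  finally show ?thesis .
qed

lemma set_pmf_sample_pmf:
  assumes "finite L"
  shows "set_pmf (sample_pmf L p) \<subseteq> Pow L"
  using assms by (auto simp: sample_pmf_def dest!: in_set_takeD permutations_of_setD(1))

lemma expectation_sample_pmf:
  fixes h :: "'l set \<Rightarrow> real"
  assumes "p \<in> {0..1}" "finite L"
  shows "measure_pmf.expectation (sample_pmf L p) h =
    (\<Sum>S\<in>Pow L. p ^ card S * (1 - p) ^ (card L - card S) * h S)"
proof -
  have "measure_pmf.expectation (sample_pmf L p) h =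
      (\<Sum>S\<in>Pow L. h S * pmf (sample_pmf L p) S)"
    by (rule integral_measure_pmf_real)
       (use assms set_pmf_sample_pmf [of L p] in auto)
  then show ?thesis
    using assms by (auto simp: pmf_sample_pmf intro!: sum.cong)
qed

text \<open>The coin of \<open>u\<close> is independent of the others, so it can be averaged out for
  a fixed sample of the remaining vertices.\<close>

lemma expectation_sample_pmf_split:
  fixes h :: "'l set \<Rightarrow> real"
  assumes p: "p \<in> {0..1}" and L: "finite L" and u: "u \<in> L"
  shows "measure_pmf.expectation (sample_pmf L p) h =
    measure_pmf.expectation (sample_pmf (L - {u}) p) (\<lambda>S. p * h (insert u S) + (1 - p) * h S)"
proof -
  let ?K = "L - {u}"
  let ?c = "\<lambda>S. p ^ card S * (1 - p) ^ (card L - card S) * h S"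
  have "Pow L = Pow ?K \<union> insert u ` Pow ?K" using u Pow_insert [of u ?K] by (simp add: insert_absorb)
  then have "sum ?c (Pow L) = sum ?c (Pow ?K) + sum ?c (insert u ` Pow ?K)"
    using L by (simp only:, subst sum.union_disjoint) auto
  also have "sum ?c (insert u ` Pow ?K) = (\<Sum>S\<in>Pow ?K. ?c (insert u S))"
    by (subst sum.reindex) (auto simp: inj_on_def)
  also have "sum ?c (Pow ?K) + (\<Sum>S\<in>Pow ?K. ?c (insert u S)) =
      (\<Sum>S\<in>Pow ?K. p ^ card S * (1 - p) ^ (card ?K - card S) * (p * h (insert u S) + (1 - p) * h S))"
    unfolding sum.distrib [symmetric]
  proof (rule sum.cong [OF refl])
    fix S assume S: "S \<in> Pow ?K"
    then have fS: "finite S" "u \<notin> S" using L finite_subset by auto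
    \<comment> \<open>When \<open>u\<close> is not sampled, the exponent of \<open>1 - p\<close> for
      \<open>L\<close> is one larger than for \<open>?K\<close>; \<open>le\<close> keeps the natural
      subtraction exact.\<close>
    have le: "card S \<le> card ?K" using S L by (auto intro: card_mono)
    have cL: "card L = Suc (card ?K)" using L u by (metis card_Suc_Diff1)
    show "?c S + ?c (insert u S) =
        p ^ card S * (1 - p) ^ (card ?K - card S) * (p * h (insert u S) + (1 - p) * h S)"
      unfolding cL card_insert_disjoint [OF fS] Suc_diff_le [OF le]
      by (simp add: algebra_simps)
  qed
  finally show ?thesis using p L by (simp add: expectation_sample_pmf)
qed

section \<open>Expectations along the process\<close>

text \<open>
  Whether \<open>u\<close> is in \<open>S\<close> influences the process only after the flip of \<open>u\<close>, so the samples \<open>S\<close> and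
  \<open>insert u S\<close> can be paired at each step.
\<close>

lemma expectation_flips_martingale:
  fixes Y :: "'l set \<Rightarrow> ('l \<times> 'r) set \<Rightarrow> real"
  assumes p: "p \<in> {0..1}" and L: "finite L" and es: "fst ` set es \<subseteq> L" "snd ` set es \<subseteq> R"
    and srt: "sorted_wrt (\<lambda>e f. w f \<le> (w e :: real)) es"
    and Y: "\<And>e F S. \<lbrakk>finite F; \<And>f. f \<in> F \<Longrightarrow> w e \<le> w f; fst e \<notin> S; fst e \<notin> fst ` F;
        snd e \<notin> snd ` heads S F; snd e \<in> R\<rbrakk> \<Longrightarrow>
        p * (Y (insert (fst e) S) (insert e F) - Y (insert (fst e) S) F) +
        (1 - p) * (Y S (insert e F) - Y S F) = 0"
  shows "measure_pmf.expectation (sample_pmf L p) (\<lambda>S. Y S (flips S es)) =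
         measure_pmf.expectation (sample_pmf L p) (\<lambda>S. Y S {})"
  using es srt
proof (induction es rule: rev_induct)
  case Nil
  show ?case by simp
next
  case (snoc e es)
  let ?E = "\<lambda>L. measure_pmf.expectation (sample_pmf L p)"
  let ?D = "\<lambda>S. Y S (flips S (es @ [e])) - Y S (flips S es)"
  have int: "integrable (sample_pmf L p) h" for h :: "'l set \<Rightarrow> real"
    using set_pmf_sample_pmf [OF L] L
    by (intro integrable_measure_pmf_finite) (auto intro: finite_subset)
  have u: "fst e \<in> L" "snd e \<in> R" using snoc.prems by auto
  have le: "w e \<le> w f" if "f \<in> flips S es" for f S
    using snoc.prems(3) that flips_subset [of S es] by (auto simp: sorted_wrt_append)
  \<comment> \<open>If \<open>fst e\<close> has already flipped, \<open>e\<close> changes neither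
    run. Otherwise both runs are in the same state, and either neither flips at \<open>e\<close> or
    \<open>Y\<close> applies.\<close>
  have "p * ?D (insert (fst e) S) + (1 - p) * ?D S = 0" if "fst e \<notin> S" for S
  proof (cases "fst e \<in> fst ` flips S es")
    case True
    then have "fst e \<in> fst ` flips (insert (fst e) S) es"
      by (simp add: covered_flips_insert_sample)
    with True show ?thesis by (simp add: flips_snoc flip_step_def)
  next
    case False
    then have "flips (insert (fst e) S) es = flips S es"
      by (rule flips_insert_sample_eq)
    with False show ?thesis using Y [of "flips S es" e S] le that u
      by (simp add: flips_snoc flip_step_def heads_insert_sample)
  qed
  then have "?E (L - {fst e}) (\<lambda>S. p * ?D (insert (fst e) S) + (1 - p) * ?D S) =
      ?E (L - {fst e}) (\<lambda>S. 0)"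
    using set_pmf_sample_pmf [of "L - {fst e}" p] L
    by (intro Bochner_Integration.integral_cong_AE) (auto simp: AE_measure_pmf_iff)
  then have "?E L ?D = 0"
    using expectation_sample_pmf_split [OF p L u(1), of ?D] by simp
  then have "?E L (\<lambda>S. Y S (flips S (es @ [e]))) = ?E L (\<lambda>S. Y S (flips S es))"
    by (simp add: Bochner_Integration.integral_diff [OF int int])
  with snoc show ?case by (simp add: sorted_wrt_append)
qed

section \<open>The potential\<close>

text \<open>Edges come by non-increasing weight, so a new tails edge is a lightest one at its right
  end.\<close>

lemma min_tail_insert:
  assumes "finite F" "\<And>f. f \<in> F \<Longrightarrow> w e \<le> w f"
  shows "min_tail w S (insert e F) r = (if fst e \<notin> S \<and> snd e = r then w e else min_tail w S F r)"
proof (cases "fst e \<notin> S \<and> snd e = r")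
  case True
  have "Min (w ` insert e {f \<in> tails S F. snd f = r}) = w e"
    by (rule Min_eqI) (use assms in \<open>auto simp: tails_def\<close>)
  moreover have "{f \<in> insert e (tails S F). snd f = r} = insert e {f \<in> tails S F. snd f = r}"
    using True by auto
  ultimately show ?thesis using True by (simp add: min_tail_def tails_insert)
next
  case False
  then have "{f \<in> tails S (insert e F). snd f = r} = {f \<in> tails S F. snd f = r}"
    by (auto simp: tails_insert)
  moreover from this have "r \<in> snd ` tails S (insert e F) \<longleftrightarrow> r \<in> snd ` tails S F" by blast
  ultimately have "min_tail w S (insert e F) r = min_tail w S F r" by (simp add: min_tail_def)
  with False show ?thesis by (simp only: if_False)
qed

lemma min_tail_nonneg:
  assumes "finite F" "\<And>f. f \<in> F \<Longrightarrow> 0 \<le> w f"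
  shows "0 \<le> min_tail w S F r"
proof (cases "r \<in> snd ` tails S F")
  case True
  then have "{e \<in> tails S F. snd e = r} \<noteq> {}" by auto
  then have "0 \<le> Min (w ` {e \<in> tails S F. snd e = r})"
    using assms by (subst Min_ge_iff) (auto simp: tails_def)
  then show ?thesis by (simp add: min_tail_def)
qed (simp add: min_tail_def)

text \<open>
  While \<open>r\<close> is uncovered, its current last tails edge is discounted by the probability \<open>p\<close> that the
  next flip at \<open>r\<close> is heads. This makes the expected increase at each flip exactly
  \<open>p (1 - p)\<close> times the weight of the flipped edge.
\<close>

definition potential :: "real \<Rightarrow> 'r set \<Rightarrow> ('l \<times> 'r \<Rightarrow> real) \<Rightarrow> 'l set \<Rightarrow> ('l \<times> 'r) set \<Rightarrow> real" where
  "potential p R w S F =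
     (\<Sum>r\<in>R. (if r \<in> snd ` heads S F then 1 else p) * min_tail w S F r)"

text \<open>Let \<open>m\<close> be the old \<open>min_tail\<close> at \<open>snd e\<close>. Heads
  lifts the factor of \<open>m\<close> from \<open>p\<close> to 1, gaining
  \<open>(1 - p) * m\<close>; tails replaces \<open>m\<close> by \<open>w e\<close> at factor
  \<open>p\<close>, gaining \<open>p * (w e - m)\<close>. In the average \<open>m\<close>
  cancels.\<close>

lemma potential_insert:
  assumes R: "finite R" and F: "finite F" "\<And>f. f \<in> F \<Longrightarrow> w e \<le> w f"
    and e: "fst e \<notin> S" "fst e \<notin> fst ` F" "snd e \<notin> snd ` heads S F" "snd e \<in> R"
  shows "p * (potential p R w (insert (fst e) S) (insert e F) - potential p R w (insert (fst e) S) F) +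
      (1 - p) * (potential p R w S (insert e F) - potential p R w S F) = p * (1 - p) * w e"
proof -
  define c where "c S F r = (if r \<in> snd ` heads S F then 1 else p) * min_tail w S F r"
    for S F and r
  \<comment> \<open>The flip affects only the summand of \<open>snd e\<close>; \<open>rest\<close>
    fixes the others.\<close>
  have pot: "potential p R w S F =
      c S F (snd e) + (\<Sum>r\<in>R - {snd e}. c S F r)" for S F
    unfolding potential_def c_def using R e(4) by (rule sum.remove)
  \<comment> \<open>No edge of \<open>F\<close> has left end \<open>fst e\<close>, so its coin is
    still irrelevant.\<close>
  have mt: "min_tail w (insert (fst e) S) F r = min_tail w S F r" for r
    using e(2) by (simp add: min_tail_def tails_insert_sample)
  have min_insert: "min_tail w S (insert e F) r =
      (if fst e \<notin> S \<and> snd e = r then w e else min_tail w S F r)" for S r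
    using F by (rule min_tail_insert)
  have rest: "c S' (insert e F) r = c S' F r" if "r \<noteq> snd e" for S' r
    using that by (auto simp: c_def heads_insert min_insert)
  have "c (insert (fst e) S) (insert e F) (snd e) = min_tail w S F (snd e)"
    by (simp add: c_def heads_insert min_insert mt)
  moreover have "c (insert (fst e) S) F (snd e) = p * min_tail w S F (snd e)"
    using e by (simp add: c_def heads_insert_sample mt)
  moreover have "c S (insert e F) (snd e) = p * w e" "c S F (snd e) = p * min_tail w S F (snd e)"
    using e by (simp_all add: c_def heads_insert min_insert)
  moreover have "(\<Sum>r\<in>R - {snd e}. c S' (insert e F) r) = (\<Sum>r\<in>R - {snd e}. c S' F r)" for S'
    by (rule sum.cong) (auto simp: rest)
  ultimately show ?thesis
    by (simp add: pot algebra_simps)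
qed

section \<open>The competitive ratio\<close>

theorem theorem2p6:
  fixes L :: "'l set" and R :: "'r set" and E :: "('l \<times> 'r) set"
    and w :: "'l \<times> 'r \<Rightarrow> real" and es :: "('l \<times> 'r) list"
    and arrival :: "'l set \<Rightarrow> 'l list" and p :: real
  assumes "p \<in> {0..1}"
    and "weighted_bipartite L R E w"
    and "weight_order E w es"
    and "\<And>S. S \<subseteq> L \<Longrightarrow> arrival S \<in> permutations_of_set (L - S)"
  shows "measure_pmf.expectation (sample_pmf L p)
           (\<lambda>S. sum w (greedy_based es S (arrival S)))
         \<ge> p * (1 - p) / (1 + p) * OPT E w"
proof -
  let ?E = "measure_pmf.expectation (sample_pmf L p)"
  let ?F = "\<lambda>S. flips S es"
  have L: "finite L" and R: "finite R" and E: "E \<subseteq> L \<times> R" and w: "\<And>e. e \<in> set es \<Longrightarrow> 0 \<le> w e"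
    and es: "set es = E" and srt: "sorted_wrt (\<lambda>e f. w f \<le> w e) es"
    using assms(2,3) by (auto simp: weighted_bipartite_def weight_order_def)
  have sub: "fst ` set es \<subseteq> L" "snd ` set es \<subseteq> R" using E es by auto
  have fl: "f \<in> set es" if "f \<in> ?F S" for f S using flips_subset that by blast
  have int: "integrable (sample_pmf L p) h" for h :: "'l set \<Rightarrow> real"
    using set_pmf_sample_pmf [OF L] L
    by (intro integrable_measure_pmf_finite) (auto intro: finite_subset)
  have mono: "?E g \<le> ?E h" if "\<And>S. S \<subseteq> L \<Longrightarrow> g S \<le> h S" for g h :: "'l set \<Rightarrow> real"
    using set_pmf_sample_pmf [OF L, of p] that
    by (intro integral_mono_AE int) (auto simp: AE_measure_pmf_iff)

  \<comment> \<open>A flip raises the heads weight by \<open>w e\<close> with probability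
    \<open>p\<close>, and the subtracted term by \<open>p * w e\<close> in either case.\<close>
  have "?E (\<lambda>S. sum w (heads S (?F S)) - p * sum w (?F S)) =
      ?E (\<lambda>S. sum w (heads S ({} :: ('l \<times> 'r) set)) - p * sum w {})"
  proof (rule expectation_flips_martingale [where w = w, OF assms(1) L sub srt])
    fix e :: "'l \<times> 'r" and F :: "('l \<times> 'r) set" and S :: "'l set"
    assume "finite F" "fst e \<notin> S" and e: "fst e \<notin> fst ` F"
    moreover from e have "e \<notin> F" by auto
    moreover from this have "e \<notin> heads S F" by (simp add: heads_def)
    ultimately show "p * (sum w (heads (insert (fst e) S) (insert e F)) - p * sum w (insert e F) -
          (sum w (heads (insert (fst e) S) F) - p * sum w F)) +
        (1 - p) * (sum w (heads S (insert e F)) - p * sum w (insert e F) -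
          (sum w (heads S F) - p * sum w F)) = 0"
      by (simp add: heads_insert heads_insert_sample algebra_simps)
  qed
  then have heads: "?E (\<lambda>S. sum w (heads S (?F S))) = p * ?E (\<lambda>S. sum w (?F S))"
    by (simp add: Bochner_Integration.integral_diff [OF int int] heads_def)

  \<comment> \<open>The subtracted term is the mean increase given by
    \<open>potential_insert\<close>, summed over the flips.\<close>
  have "?E (\<lambda>S. potential p R w S (?F S) - p * (1 - p) * sum w (?F S)) =
      ?E (\<lambda>S. potential p R w S {} - p * (1 - p) * sum w {})"
  proof (rule expectation_flips_martingale [where w = w, OF assms(1) L sub srt])
    fix e :: "'l \<times> 'r" and F :: "('l \<times> 'r) set" and S :: "'l set"
    assume *: "finite F" "\<And>f. f \<in> F \<Longrightarrow> w e \<le> w f" "fst e \<notin> S" "fst e \<notin> fst ` F"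
      "snd e \<notin> snd ` heads S F" "snd e \<in> R"
    have "sum w (insert e F) = w e + sum w F" using * by (subst sum.insert) auto
    with potential_insert [where w = w and e = e and p = p, OF R *]
    show "p * (potential p R w (insert (fst e) S) (insert e F) - p * (1 - p) * sum w (insert e F) -
          (potential p R w (insert (fst e) S) F - p * (1 - p) * sum w F)) +
        (1 - p) * (potential p R w S (insert e F) - p * (1 - p) * sum w (insert e F) -
          (potential p R w S F - p * (1 - p) * sum w F)) = 0"
      by (simp add: algebra_simps)
  qed
  then have pot: "?E (\<lambda>S. potential p R w S (?F S)) = p * (1 - p) * ?E (\<lambda>S. sum w (?F S))"
    by (simp add: Bochner_Integration.integral_diff [OF int int] potential_def min_tail_def tails_def)

  \<comment> \<open>In the bound on the optimum the flips count once and the heads edges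
    \<open>p\<close> times in expectation, whence \<open>1 + p\<close>.\<close>
  have "OPT E w = ?E (\<lambda>S. OPT E w)" by simp
  also have "\<dots> \<le> ?E (\<lambda>S. sum w (?F S) + sum w (heads S (?F S)))"
    by (intro mono OPT_le matching_weight_le_flips srt w) (auto simp: es [symmetric])
  also have "\<dots> = (1 + p) * ?E (\<lambda>S. sum w (?F S))"
    by (simp add: Bochner_Integration.integral_add [OF int int] heads algebra_simps)
  finally have "OPT E w / (1 + p) \<le> ?E (\<lambda>S. sum w (?F S))"
    using assms(1) by (simp add: field_simps)
  then have "p * (1 - p) * (OPT E w / (1 + p)) \<le> p * (1 - p) * ?E (\<lambda>S. sum w (?F S))"
    using assms(1) by (intro mult_left_mono) auto
  also have "\<dots> = ?E (\<lambda>S. potential p R w S (?F S))" by (simp add: pot)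
  also have "\<dots> \<le> ?E (\<lambda>S. sum w (greedy_based es S (arrival S)))"
  proof (rule mono)
    fix S assume S: "S \<subseteq> L"
    have nonneg: "0 \<le> min_tail w S (?F S) r" for r
      using w fl by (intro min_tail_nonneg) auto
    \<comment> \<open>Both factors 1 and \<open>p\<close> are at most 1, so the potential
      underestimates the secured weight.\<close>
    have "potential p R w S (?F S) \<le> (\<Sum>r\<in>R. min_tail w S (?F S) r)"
      unfolding potential_def using assms(1) nonneg
      by (intro sum_mono) (auto intro: mult_left_le_one_le)
    also have "\<dots> \<le> sum w (greedy_based es S (arrival S))"
    proof (rule sum_greedy_based_ge [OF R])
      have "set (arrival S) = L - S"
        using assms(4) [OF S] by (rule permutations_of_setD)
      then show "fst ` ?F S - S \<subseteq> set (arrival S)" "set (arrival S) \<inter> S = {}"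
        using sub(1) flips_subset [of S es] by auto
      show "snd ` ?F S \<subseteq> R"
        using sub(2) flips_subset [of S es] by blast
    qed
    finally show "potential p R w S (?F S) \<le> sum w (greedy_based es S (arrival S))" .
  qed
  finally show ?thesis by (simp add: mult.commute)
qed

end
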